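(* Let $n\ge 1$ and let $G\subset\mathfrak{S}_n$ be a permutation group. Then, in $\mathrm{BWSym}$, $$\mathbb{Z}_G:=\sum_{\sigma\in G}\Phi^{\binom{\sigma}{\mathrm{cycle\_support}(\sigma)}}=\sum_{\pi}\ \sum_{\sigma\in \mathrm{Stab}_\pi(G)}M_{\binom{\sigma}{\pi}},$$ where $\pi$ ranges over all set partitions of $\{1,\dots,n\}$.
   Context: For set partitions $\pi,\pi'$ of $\{1,\dots,n\}$, write $\pi\le\pi'$ if $\pi$ is finer than (or equal to) $\pi'$, i.e. each block of $\pi'$ is a union of blocks of $\pi$. For $\sigma\in\mathfrak{S}_n$, $\mathrm{cycle\_support}(\sigma)$ is the set partition of $\{1,\dots,n\}$ whose blocks are the supports of the cycles of $\sigma$ (fixed points included as singletons). A set partition into lists of size $n$ is a set partition of $\{1,\dots,n\}$ together with a total ordering (a list) of the elements of each block. Set partitions into lists $\Pi$ of size $n$ are encoded by pairs $\binom{\sigma}{\pi}$ with $\sigma\in\mathfrak{S}_n$ and $\pi$ a set partition of $\{1,\dots,n\}$ such that $\mathrm{cycle\_support}(\sigma)\le\pi$: the underlying set partition of $\Pi$ is $\pi$, and the elements of each block are listed in the order in which they appear in the one-line notation $\sigma(1)\sigma(2)\cdots\sigma(n)$. This encoding is bijective. $\mathrm{BWSym}$ is the graded complex vector space (in fact a Hopf algebra, whose product and coproduct are not needed here) with basis $(\Phi^\Pi)$ indexed by set partitions into lists; one writes $\Phi^{\binom{\sigma}{\pi}}$ for $\Phi^\Pi$ when $\Pi$ is encoded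 by $\binom{\sigma}{\pi}$. The basis $(M_\Pi)$, also written $M_{\binom{\sigma}{\pi}}$, is defined by $$\Phi^{\binom{\sigma}{\pi}}=\sum_{\pi\le\pi'}M_{\binom{\sigma}{\pi'}}.$$ For a set partition $\pi$ of $\{1,\dots,n\}$, $\mathrm{Stab}_\pi(G)$ denotes the set of $\sigma\in G$ that fix a word $w_\pi=a_1\cdots a_n$ satisfying $a_i=a_j$ if and only if $i,j$ lie in the same block of $\pi$, where $\sigma$ acts by $w\sigma=a_{\sigma(1)}\cdots a_{\sigma(n)}$; that is, the set of $\sigma\in G$ with $\sigma(B)=B$ for every block $B$ of $\pi$. *)

theory Defs
  imports
    Complex_Main
    "HOL-Library.Disjoint_Sets"
    "HOL-Library.Poly_Mapping"
    "HOL-Combinatorics.Orbits"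
    "HOL-Algebra.Sym_Groups"
begin

section \<open>Set partitions and cycle supports\<close>

text \<open>
  Set partitions of \<open>{1..n}\<close> are given by \<^const>\<open>partition_on\<close>, and \<open>\<pi> \<le> \<pi>'\<close> (finer or
  equal) is \<^term>\<open>refines {1..n} \<pi> \<pi>'\<close>, which includes that both are set partitions.
\<close>

lemma partition_block_eq:
  assumes "partition_on A P" "X \<in> P" "Y \<in> P" "x \<in> X" "x \<in> Y"
  shows "X = Y"
  using partition_onD2[OF assms(1)] assms(2-) unfolding disjoint_def by blast

lemma refines_iff_union_of_blocks:
  assumes P: "partition_on A P" and Q: "partition_on A Q"
  shows "refines A P Q \<longleftrightarrow> (\<forall>Y\<in>Q. \<exists>S\<subseteq>P. Y = \<Union>S)"
proof
  assume *: "refines A P Q"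
  show "\<forall>Y\<in>Q. \<exists>S\<subseteq>P. Y = \<Union>S"
  proof
    fix Y assume "Y \<in> Q"
    then have "partition_on Y {p \<in> P. p \<subseteq> Y}" using * refines_obtains_subset by blast
    then have "{p \<in> P. p \<subseteq> Y} \<subseteq> P \<and> Y = \<Union>{p \<in> P. p \<subseteq> Y}" by (auto simp: partition_on_def)
    then show "\<exists>S\<subseteq>P. Y = \<Union>S" by (rule exI)
  qed
next
  assume *: "\<forall>Y\<in>Q. \<exists>S\<subseteq>P. Y = \<Union>S"
  have "\<exists>Y\<in>Q. X \<subseteq> Y" if X: "X \<in> P" for X
  proof -
    obtain x where x: "x \<in> X" using X P by (metis all_not_in_conv partition_onD3)
    then have "x \<in> A" using X P by (auto simp: partition_on_def)
    then obtain Y where Y: "Y \<in> Q" "x \<in> Y" using Q by (auto simp: partition_on_def)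
    then obtain S where S: "S \<subseteq> P" "Y = \<Union>S" using * by blast
    then obtain X' where X': "X' \<in> S" "x \<in> X'" using Y by blast
    then have "X' = X" using partition_block_eq[OF P _ X X'(2) x] X'(1) S(1) by blast
    then have "X \<subseteq> Y" using X'(1) S(2) by (simp add: Sup_upper)
    then show ?thesis using Y(1) by (rule bexI)
  qed
  then show "refines A P Q" using P Q by (simp add: refines_def)
qed

text \<open>For a permutation, \<^term>\<open>orbit \<sigma> i\<close> is the support of the cycle through \<open>i\<close>; it is
  \<open>{i}\<close> at a fixed point.\<close>

definition cycle_support :: "nat \<Rightarrow> (nat \<Rightarrow> nat) \<Rightarrow> nat set set" where
  "cycle_support n \<sigma> = orbit \<sigma> ` {1..n}"

lemma self_in_orbit:
  assumes "\<sigma> permutes {1..n::nat}"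
  shows "i \<in> orbit \<sigma> i"
proof (rule permutation_self_in_orbit)
  show "permutation \<sigma>" unfolding permutation_permutes using assms by (intro exI[of _ "{1..n}"]) simp
qed

lemma partition_on_cycle_support:
  assumes s: "\<sigma> permutes {1..n}"
  shows "partition_on {1..n} (cycle_support n \<sigma>)"
proof (rule partition_onI)
  have "orbit \<sigma> i \<subseteq> {1..n}" if "i \<in> {1..n}" for i
    using permutes_orbit_subset[OF s that] .
  moreover have "i \<in> (\<Union>j\<in>{1..n}. orbit \<sigma> j)" if "i \<in> {1..n}" for i
    using self_in_orbit[OF s, of i] that by (rule UN_I[rotated])
  ultimately show "\<Union>(cycle_support n \<sigma>) = {1..n}"
    unfolding cycle_support_def by (intro subset_antisym subsetI) (auto simp del: atLeastAtMost_iff)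
  show "{} \<notin> cycle_support n \<sigma>"
    using self_in_orbit[OF s] unfolding cycle_support_def by (metis emptyE imageE)
  show "disjnt p q" if pq: "p \<in> cycle_support n \<sigma>" "q \<in> cycle_support n \<sigma>" "p \<noteq> q" for p q
  proof (rule ccontr)
    assume "\<not> disjnt p q"
    then obtain x where x: "x \<in> p" "x \<in> q" by (auto simp: disjnt_def)
    obtain i j where ij: "p = orbit \<sigma> i" "q = orbit \<sigma> j"
      using pq unfolding cycle_support_def by blast
    have "orbit \<sigma> i = orbit \<sigma> x" if "x \<in> orbit \<sigma> i" for i
    proof (intro subset_antisym subsetI)
      have xi: "i \<in> orbit \<sigma> x" using orbit_swap[OF self_in_orbit[OF s] that] .
      show "y \<in> orbit \<sigma> x" if "y \<in> orbit \<sigma> i" for y using orbit_trans[OF that xi] .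
      show "y \<in> orbit \<sigma> i" if "y \<in> orbit \<sigma> x" for y using orbit_trans[OF that \<open>x \<in> orbit \<sigma> i\<close>] .
    qed
    then show False using x ij \<open>p \<noteq> q\<close> by metis
  qed
qed

section \<open>Set partitions into lists\<close>

definition set_partition_into_lists :: "nat \<Rightarrow> nat list set \<Rightarrow> bool" where
  "set_partition_into_lists n \<L> \<longleftrightarrow>
     partition_on {1..n} (set ` \<L>) \<and> inj_on set \<L> \<and> (\<forall>l\<in>\<L>. distinct l)"

typedef spl = "{\<L>. \<exists>n. set_partition_into_lists n \<L>}"
proof
  show "{} \<in> {\<L>. \<exists>n. set_partition_into_lists n \<L>}"
    by (auto simp: set_partition_into_lists_def partition_on_def intro!: exI[of _ 0])
qed

definition encodes :: "nat \<Rightarrow> (nat \<Rightarrow> nat) \<Rightarrow> nat set set \<Rightarrow> bool" where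
  "encodes n \<sigma> \<pi> \<longleftrightarrow> \<sigma> permutes {1..n} \<and> refines {1..n} (cycle_support n \<sigma>) \<pi>"

definition block_list :: "nat \<Rightarrow> (nat \<Rightarrow> nat) \<Rightarrow> nat set \<Rightarrow> nat list" where
  "block_list n \<sigma> B = filter (\<lambda>x. x \<in> B) (map \<sigma> [1..<Suc n])"

text \<open>Meaningful only for pairs satisfying \<^const>\<open>encodes\<close>; see \<open>bij_betw_spl_of\<close> below.\<close>

definition spl_of :: "nat \<Rightarrow> (nat \<Rightarrow> nat) \<Rightarrow> nat set set \<Rightarrow> spl" where
  "spl_of n \<sigma> \<pi> = Abs_spl (block_list n \<sigma> ` \<pi>)"

lemma encodes_iff_blocks_invariant:
  assumes s: "\<sigma> permutes {1..n}" and p: "partition_on {1..n} \<pi>"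
  shows "encodes n \<sigma> \<pi> \<longleftrightarrow> (\<forall>B\<in>\<pi>. \<sigma> ` B = B)"
proof
  assume e: "encodes n \<sigma> \<pi>"
  show "\<forall>B\<in>\<pi>. \<sigma> ` B = B"
  proof
    fix B assume B: "B \<in> \<pi>"
    have Bn: "B \<subseteq> {1..n}" using p B unfolding partition_on_def by blast
    have "\<sigma> ` B \<subseteq> B"
    proof
      fix y assume "y \<in> \<sigma> ` B"
      then obtain x where x: "x \<in> B" "y = \<sigma> x" by blast
      then have "orbit \<sigma> x \<in> cycle_support n \<sigma>" using Bn by (auto simp: cycle_support_def)
      then obtain Y where Y: "Y \<in> \<pi>" "orbit \<sigma> x \<subseteq> Y"
        using e unfolding encodes_def refines_def by blast
      have "x \<in> Y" "y \<in> Y" using Y x self_in_orbit[OF s] orbit.base[of \<sigma> x] by auto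
      then have "Y = B" using partition_block_eq[OF p Y(1) B _ x(1)] by simp
      then show "y \<in> B" using \<open>y \<in> Y\<close> by simp
    qed
    then show "\<sigma> ` B = B"
      by (meson Bn endo_inj_surj finite_atLeastAtMost finite_subset inj_on_subset
          permutes_inj_on s)
  qed
next
  assume inv: "\<forall>B\<in>\<pi>. \<sigma> ` B = B"
  have "\<exists>Y\<in>\<pi>. X \<subseteq> Y" if X: "X \<in> cycle_support n \<sigma>" for X
  proof -
    obtain i where i: "i \<in> {1..n}" "X = orbit \<sigma> i" using X by (auto simp: cycle_support_def)
    then obtain B where B: "B \<in> \<pi>" "i \<in> B" using p unfolding partition_on_def by blast
    have "y \<in> B" if "y \<in> orbit \<sigma> i" for y
      using that by induction (use inv B in blast)+
    then show ?thesis using B i by blast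
  qed
  then show "encodes n \<sigma> \<pi>"
    using s p partition_on_cycle_support by (simp add: encodes_def refines_def)
qed

lemma encodes_partition: "encodes n \<sigma> \<pi> \<Longrightarrow> partition_on {1..n} \<pi>"
  by (simp add: encodes_def refines_def)

lemma encodes_coarser: "encodes n \<sigma> \<pi> \<Longrightarrow> refines {1..n} \<pi> \<pi>' \<Longrightarrow> encodes n \<sigma> \<pi>'"
  unfolding encodes_def using refines_trans by blast

lemma block_list_conv:
  assumes e: "encodes n \<sigma> \<pi>" and B: "B \<in> \<pi>"
  shows "block_list n \<sigma> B = map \<sigma> (filter (\<lambda>x. x \<in> B) [1..<Suc n])"
proof -
  have s: "\<sigma> permutes {1..n}" using e by (simp add: encodes_def)
  have "\<sigma> ` B = B" using e B encodes_iff_blocks_invariant encodes_partition s by blast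
  then have "\<sigma> x \<in> B \<longleftrightarrow> x \<in> B" for x
    by (metis imageE imageI permutes_def s)
  then show ?thesis by (simp add: block_list_def filter_map comp_def del: upt_Suc)
qed

lemma set_block_list:
  assumes s: "\<sigma> permutes {1..n}" and B: "B \<subseteq> {1..n}"
  shows "set (block_list n \<sigma> B) = B"
proof -
  have "\<sigma> ` {1..<Suc n} = {1..<Suc n}"
    using permutes_image[OF s] by (simp add: atLeastLessThanSuc_atLeastAtMost)
  moreover have "B \<subseteq> {1..<Suc n}" using B by (auto simp: subset_iff)
  ultimately show ?thesis
    unfolding block_list_def by (auto simp del: upt_Suc)
qed

lemma distinct_block_list: "\<sigma> permutes {1..n} \<Longrightarrow> distinct (block_list n \<sigma> B)"
  unfolding block_list_def
  by (intro distinct_filter) (simp add: distinct_map permutes_inj_on del: upt_Suc)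

lemma set_image_block_list:
  assumes "encodes n \<sigma> \<pi>"
  shows "set ` block_list n \<sigma> ` \<pi> = \<pi>"
proof -
  have "set (block_list n \<sigma> B) = B" if "B \<in> \<pi>" for B
    using assms that encodes_partition[OF assms]
    by (intro set_block_list) (auto simp: encodes_def partition_on_def)
  then show ?thesis by (simp add: image_image)
qed

lemma set_partition_into_lists_block_list:
  assumes e: "encodes n \<sigma> \<pi>"
  shows "set_partition_into_lists n (block_list n \<sigma> ` \<pi>)"
proof -
  have s: "\<sigma> permutes {1..n}" using e by (simp add: encodes_def)
  have "set (block_list n \<sigma> B) = B" if "B \<in> \<pi>" for B
    using s that encodes_partition[OF e]
    by (intro set_block_list) (auto simp: partition_on_def)
  then have "inj_on set (block_list n \<sigma> ` \<pi>)" by (auto intro!: inj_onI)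
  then show ?thesis
    using set_image_block_list[OF e] encodes_partition[OF e] distinct_block_list[OF s]
    by (auto simp: set_partition_into_lists_def)
qed

lemma block_list_inj:
  assumes e: "encodes n \<sigma> \<pi>" and e': "encodes n \<sigma>' \<pi>'"
    and eq: "block_list n \<sigma> ` \<pi> = block_list n \<sigma>' ` \<pi>'"
  shows "\<sigma> = \<sigma>' \<and> \<pi> = \<pi>'"
proof -
  have s: "\<sigma> permutes {1..n}" "\<sigma>' permutes {1..n}" using e e' by (auto simp: encodes_def)
  have pp: "\<pi> = \<pi>'" using set_image_block_list[OF e] set_image_block_list[OF e'] eq by simp
  have p: "partition_on {1..n} \<pi>" using encodes_partition[OF e] .
  have "\<sigma> x = \<sigma>' x" if x: "x \<in> {1..n}" for x
  proof -
    obtain B where B: "B \<in> \<pi>" "x \<in> B" using x p unfolding partition_on_def by blast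
    have sub: "C \<subseteq> {1..n}" if "C \<in> \<pi>" for C using p that unfolding partition_on_def by blast
    obtain C where C: "C \<in> \<pi>" "block_list n \<sigma> B = block_list n \<sigma>' C"
      using eq B pp by blast
    then have "B = C" using set_block_list[OF s(1) sub[OF B(1)]] set_block_list[OF s(2) sub[OF C(1)]]
      by simp
    then have "map \<sigma> (filter (\<lambda>x. x \<in> B) [1..<Suc n]) = map \<sigma>' (filter (\<lambda>x. x \<in> B) [1..<Suc n])"
      using C block_list_conv[OF e B(1)] block_list_conv[OF e'] B(1) pp by metis
    then show ?thesis using B x by (auto simp del: upt_Suc)
  qed
  then have "\<sigma> = \<sigma>'" using s by (metis ext permutes_not_in)
  with pp show ?thesis by simp
qed

lemma block_list_surj:
  assumes P: "set_partition_into_lists n \<L>"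
  shows "\<exists>\<sigma> \<pi>. encodes n \<sigma> \<pi> \<and> block_list n \<sigma> ` \<pi> = \<L>"
proof -
  define \<pi> where "\<pi> = set ` \<L>"
  define pos where "pos B = filter (\<lambda>x. x \<in> B) [1..<Suc n]" for B
  have p: "partition_on {1..n} \<pi>" and inj: "inj_on set \<L>" and d: "\<And>l. l \<in> \<L> \<Longrightarrow> distinct l"
    using P by (auto simp: set_partition_into_lists_def \<pi>_def)
  have sub: "set l \<subseteq> {1..n}" if "l \<in> \<L>" for l using p that unfolding partition_on_def \<pi>_def by blast
  have setpos: "set (pos (set l)) = set l" if "l \<in> \<L>" for l
    using sub[OF that] by (auto simp: pos_def simp del: upt_Suc)
  have dpos: "distinct (pos B)" for B by (simp add: pos_def del: upt_Suc)
  have len: "length (pos (set l)) = length l" if "l \<in> \<L>" for l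
    using setpos[OF that] dpos d[OF that] by (metis distinct_card)
  have "\<exists>f. map f (pos (set l)) = l" if l: "l \<in> \<L>" for l
    using map_of_zip_map[of "pos (set l)"] len[OF l] dpos
    by (intro exI[of _ "\<lambda>x. the (map_of (zip (pos (set l)) l) x)"] nth_equalityI)
       (auto simp: map_of_zip_nth)
  then obtain f where f: "\<And>l. l \<in> \<L> \<Longrightarrow> map (f l) (pos (set l)) = l" by metis
  have ex1: "\<exists>!l. l \<in> \<L> \<and> x \<in> set l" if "x \<in> {1..n}" for x
  proof -
    have "\<exists>l. l \<in> \<L> \<and> x \<in> set l" using p that unfolding partition_on_def \<pi>_def by blast
    moreover have "l = l'" if "l \<in> \<L>" "x \<in> set l" "l' \<in> \<L>" "x \<in> set l'" for l l'
    proof -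
      have "set l = set l'" using partition_block_eq[OF p, of "set l" "set l'" x] that by (simp add: \<pi>_def)
      then show ?thesis using inj that by (meson inj_onD)
    qed
    ultimately show ?thesis by blast
  qed
  define L where "L x = (THE l. l \<in> \<L> \<and> x \<in> set l)" for x
  have L: "L x = l" if "l \<in> \<L>" "x \<in> set l" for x l
    unfolding L_def using ex1[of x] sub[OF that(1)] that by (intro the1_equality) blast+
  define \<sigma> where "\<sigma> x = (if x \<in> {1..n} then f (L x) x else x)" for x
  have map\<sigma>: "map \<sigma> (pos (set l)) = l" if l: "l \<in> \<L>" for l
  proof -
    have "map \<sigma> (pos (set l)) = map (f l) (pos (set l))"
    proof (rule map_cong[OF refl])
      fix x assume "x \<in> set (pos (set l))"
      then have "x \<in> set l" using setpos[OF l] by simp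
      then show "\<sigma> x = f l x" using L[OF l] sub[OF l] by (auto simp: \<sigma>_def)
    qed
    then show ?thesis using f[OF l] by simp
  qed
  have img: "\<sigma> ` set l = set l" if "l \<in> \<L>" for l
    using arg_cong[OF map\<sigma>[OF that], of set] setpos[OF that] by simp
  have surj: "\<sigma> ` {1..n} = {1..n}"
  proof -
    have "{1..n} = \<Union>(set ` \<L>)" using p by (simp add: partition_on_def \<pi>_def)
    then show ?thesis using img by (simp add: image_Union image_image)
  qed
  have "bij_betw \<sigma> {1..n} {1..n}"
    using surj by (simp add: bij_betw_def eq_card_imp_inj_on)
  then have s: "\<sigma> permutes {1..n}" by (rule bij_imp_permutes) (auto simp: \<sigma>_def)
  have e: "encodes n \<sigma> \<pi>"
    using encodes_iff_blocks_invariant[OF s p] img by (auto simp: \<pi>_def)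
  have "block_list n \<sigma> (set l) = l" if "l \<in> \<L>" for l
    using block_list_conv[OF e] that map\<sigma>[OF that] by (simp add: \<pi>_def pos_def del: upt_Suc)
  then have "block_list n \<sigma> ` \<pi> = \<L>" by (simp add: \<pi>_def image_image)
  with e show ?thesis by blast
qed

lemma set_partition_into_lists_size_unique:
  assumes "set_partition_into_lists n \<L>" "set_partition_into_lists m \<L>"
  shows "n = m"
  using assms unfolding set_partition_into_lists_def partition_on_def
  by (metis card_atLeastAtMost diff_Suc_1)

lemma Rep_spl_of:
  assumes "encodes n \<sigma> \<pi>"
  shows "Rep_spl (spl_of n \<sigma> \<pi>) = block_list n \<sigma> ` \<pi>"
  unfolding spl_of_def using set_partition_into_lists_block_list[OF assms]
  by (intro Abs_spl_inverse) blast

lemma bij_betw_spl_of: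
  "bij_betw (\<lambda>(\<sigma>, \<pi>). spl_of n \<sigma> \<pi>) {(\<sigma>, \<pi>). encodes n \<sigma> \<pi>}
     {\<L>. set_partition_into_lists n (Rep_spl \<L>)}"
proof (intro bij_betwI' ; clarsimp)
  show "(spl_of n \<sigma> \<pi> = spl_of n \<sigma>' \<pi>') = (\<sigma> = \<sigma>' \<and> \<pi> = \<pi>')"
    if "encodes n \<sigma> \<pi>" "encodes n \<sigma>' \<pi>'" for \<sigma> \<pi> \<sigma>' \<pi>'
    using that block_list_inj by (metis Rep_spl_of)
  show "set_partition_into_lists n (Rep_spl (spl_of n \<sigma> \<pi>))" if "encodes n \<sigma> \<pi>" for \<sigma> \<pi>
    using that by (simp add: Rep_spl_of set_partition_into_lists_block_list)
  show "\<exists>\<sigma> \<pi>. encodes n \<sigma> \<pi> \<and> \<L> = spl_of n \<sigma> \<pi>"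
    if "set_partition_into_lists n (Rep_spl \<L>)" for \<L>
    using block_list_surj[OF that] by (metis Rep_spl_inverse spl_of_def)
qed

lemma spl_of_eq_iff:
  assumes e: "encodes n \<sigma> \<pi>" and e': "encodes m \<sigma>' \<pi>'"
  shows "spl_of n \<sigma> \<pi> = spl_of m \<sigma>' \<pi>' \<longleftrightarrow> n = m \<and> \<sigma> = \<sigma>' \<and> \<pi> = \<pi>'"
  using e e' set_partition_into_lists_size_unique block_list_inj
    set_partition_into_lists_block_list by (metis Rep_spl_of)

lemma ex_encodes: "\<exists>n \<sigma> \<pi>. encodes n \<sigma> \<pi> \<and> \<L> = spl_of n \<sigma> \<pi>"
proof -
  obtain n where "set_partition_into_lists n (Rep_spl \<L>)" using Rep_spl[of \<L>] by blast
  then obtain \<sigma> \<pi> where e: "encodes n \<sigma> \<pi>" "block_list n \<sigma> ` \<pi> = Rep_spl \<L>"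
    using block_list_surj by blast
  have "\<L> = spl_of n \<sigma> \<pi>" unfolding spl_of_def e(2) by (rule Rep_spl_inverse[symmetric])
  with e(1) show ?thesis by blast
qed

section \<open>The space BWSym and its bases\<close>

type_synonym bwsym = "spl \<Rightarrow>\<^sub>0 complex"

definition Phi_basis :: "spl \<Rightarrow> bwsym" where
  "Phi_basis \<L> = Poly_Mapping.single \<L> 1"

definition M_relations :: "(spl \<Rightarrow> bwsym) \<Rightarrow> bool" where
  "M_relations M \<longleftrightarrow>
     (\<forall>n \<sigma> \<pi>. encodes n \<sigma> \<pi> \<longrightarrow>
        Phi_basis (spl_of n \<sigma> \<pi>) = (\<Sum>\<pi>' | refines {1..n} \<pi> \<pi>'. M (spl_of n \<sigma> \<pi>')))"

text \<open>The relations determine the family uniquely: see \<open>ex1_M_relations\<close> below.\<close>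

definition M_basis :: "spl \<Rightarrow> bwsym" where
  "M_basis = (THE M. M_relations M)"

lemma finite_coarser: "finite {\<pi>'. refines {1..n::nat} \<pi> \<pi>' \<and> Q \<pi>'}"
  by (rule finite_subset[OF _ finitely_many_partition_on[of "{1..n}"]]) (auto simp: refines_def)

lemma card_coarser_less:
  assumes r: "refines A P Q" and ne: "P \<noteq> Q" and fin: "finite A"
  shows "card Q < card P"
proof -
  have pP: "partition_on A P" and pQ: "partition_on A Q" using r by (auto simp: refines_def)
  obtain f where f: "\<And>X. X \<in> P \<Longrightarrow> f X \<in> Q \<and> X \<subseteq> f X"
    using r unfolding refines_def by metis
  have eqQ: "Y = Y'" if "Y \<in> Q" "Y' \<in> Q" "y \<in> Y" "y \<in> Y'" for Y Y' y
    using partition_block_eq[OF pQ that] .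
  have cov: "\<exists>X\<in>P. y \<in> X" if "y \<in> Y" "Y \<in> Q" for y Y
    using pP pQ that unfolding partition_on_def by blast
  have fP: "finite P" using finite_elements[OF fin pP] .
  have "Y \<in> f ` P" if Y: "Y \<in> Q" for Y
  proof -
    obtain y where y: "y \<in> Y" using Y pQ by (metis all_not_in_conv partition_onD3)
    then obtain X where "X \<in> P" "y \<in> X" using cov Y by blast
    then have "f X = Y" using f eqQ Y y by blast
    then show ?thesis using \<open>X \<in> P\<close> by blast
  qed
  then have img: "f ` P = Q" using f by blast
  have "card Q \<noteq> card P"
  proof
    assume "card Q = card P"
    then have inj: "inj_on f P" using img fP by (metis eq_card_imp_inj_on)
    have "f X = X" if X: "X \<in> P" for X
    proof (rule ccontr)
      assume "f X \<noteq> X"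
      then obtain y where y: "y \<in> f X" "y \<notin> X" using f[OF X] by blast
      then obtain X' where X': "X' \<in> P" "y \<in> X'" using cov f[OF X] by blast
      then have "f X' = f X" using f X eqQ y by blast
      then have "X' = X" using inj X X' by (meson inj_onD)
      then show False using y X' by simp
    qed
    then show False using img ne by simp
  qed
  moreover have "card Q \<le> card P" using img fP card_image_le by blast
  ultimately show ?thesis by simp
qed

lemma sum_coarser_split:
  fixes g :: "nat set set \<Rightarrow> 'b::comm_monoid_add"
  assumes "partition_on {1..n} \<pi>"
  shows "(\<Sum>\<pi>' | refines {1..n} \<pi> \<pi>'. g \<pi>') =
    g \<pi> + (\<Sum>\<pi>' | refines {1..n} \<pi> \<pi>' \<and> \<pi>' \<noteq> \<pi>. g \<pi>')"
proof -
  have "{\<pi>'. refines {1..n} \<pi> \<pi>'} = insert \<pi> {\<pi>'. refines {1..n} \<pi> \<pi>' \<and> \<pi>' \<noteq> \<pi>}"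
    using refines_refl[OF assms] by auto
  then show ?thesis by (simp add: finite_coarser del: One_nat_def)
qed

text \<open>An auxiliary solution of the triangular system, for the existence part.\<close>

function M_rec :: "nat \<Rightarrow> (nat \<Rightarrow> nat) \<Rightarrow> nat set set \<Rightarrow> bwsym" where
  "M_rec n \<sigma> \<pi> = Phi_basis (spl_of n \<sigma> \<pi>) -
     (\<Sum>\<pi>' \<in> {\<pi>'. refines {1..n} \<pi> \<pi>' \<and> \<pi>' \<noteq> \<pi>}. M_rec n \<sigma> \<pi>')"
  by auto
termination
  by (relation "measure (\<lambda>(n, \<sigma>, \<pi>). card \<pi>)") (auto intro: card_coarser_less)

declare M_rec.simps [simp del]

lemma ex1_M_relations: "\<exists>!M. M_relations M"
proof (rule ex_ex1I)
  obtain N S P where NSP: "\<And>\<L>. encodes (N \<L>) (S \<L>) (P \<L>) \<and> \<L> = spl_of (N \<L>) (S \<L>) (P \<L>)"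
    using ex_encodes by metis
  define M where "M \<L> = M_rec (N \<L>) (S \<L>) (P \<L>)" for \<L>
  have M: "M (spl_of n \<sigma> \<pi>) = M_rec n \<sigma> \<pi>" if "encodes n \<sigma> \<pi>" for n \<sigma> \<pi>
    using NSP[of "spl_of n \<sigma> \<pi>"] spl_of_eq_iff[OF that] unfolding M_def by metis
  have "M_relations M"
    unfolding M_relations_def
  proof (intro allI impI)
    fix n \<sigma> \<pi> assume e: "encodes n \<sigma> \<pi>"
    have "(\<Sum>\<pi>' | refines {1..n} \<pi> \<pi>'. M (spl_of n \<sigma> \<pi>')) =
        (\<Sum>\<pi>' | refines {1..n} \<pi> \<pi>'. M_rec n \<sigma> \<pi>')"
      using M encodes_coarser[OF e] by (intro sum.cong) auto
    also have "\<dots> = Phi_basis (spl_of n \<sigma> \<pi>)"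
      by (subst sum_coarser_split[OF encodes_partition[OF e]], subst M_rec.simps) simp
    finally show "Phi_basis (spl_of n \<sigma> \<pi>) = (\<Sum>\<pi>' | refines {1..n} \<pi> \<pi>'. M (spl_of n \<sigma> \<pi>'))" ..
  qed
  then show "\<exists>M. M_relations M" by blast
next
  fix M M' assume M: "M_relations M" "M_relations M'"
  have *: "M (spl_of n \<sigma> \<pi>) = M' (spl_of n \<sigma> \<pi>)" if "encodes n \<sigma> \<pi>" for n \<sigma> \<pi>
    using that
  proof (induction "card \<pi>" arbitrary: \<pi> rule: less_induct)
    case less
    have "(\<Sum>\<pi>' | refines {1..n} \<pi> \<pi>'. M (spl_of n \<sigma> \<pi>')) =
        (\<Sum>\<pi>' | refines {1..n} \<pi> \<pi>'. M' (spl_of n \<sigma> \<pi>'))"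
      using M[unfolded M_relations_def, rule_format, OF less.prems] by simp
    moreover have "(\<Sum>\<pi>' | refines {1..n} \<pi> \<pi>' \<and> \<pi>' \<noteq> \<pi>. M (spl_of n \<sigma> \<pi>')) =
        (\<Sum>\<pi>' | refines {1..n} \<pi> \<pi>' \<and> \<pi>' \<noteq> \<pi>. M' (spl_of n \<sigma> \<pi>'))"
      using less.hyps encodes_coarser[OF less.prems]
      by (intro sum.cong) (auto intro: card_coarser_less)
    ultimately show ?case
      by (simp add: sum_coarser_split[OF encodes_partition[OF less.prems]] del: One_nat_def)
  qed
  show "M = M'"
  proof
    fix \<L> show "M \<L> = M' \<L>" using ex_encodes[of \<L>] * by auto
  qed
qed

lemma M_basis_relations: "M_relations M_basis"
  unfolding M_basis_def using ex1_M_relations by (rule theI')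

section \<open>Stabilizers and the element attached to a group\<close>

text \<open>Positions in words are numbered from 1, while list indices start at 0.\<close>

definition word_of_partition :: "nat \<Rightarrow> nat set set \<Rightarrow> nat list \<Rightarrow> bool" where
  "word_of_partition n \<pi> w \<longleftrightarrow> length w = n \<and>
     (\<forall>i\<in>{1..n}. \<forall>j\<in>{1..n}. w ! (i - 1) = w ! (j - 1) \<longleftrightarrow> (\<exists>B\<in>\<pi>. i \<in> B \<and> j \<in> B))"

definition word_act :: "nat list \<Rightarrow> (nat \<Rightarrow> nat) \<Rightarrow> nat list" where
  "word_act w \<sigma> = map (\<lambda>i. w ! (\<sigma> i - 1)) [1..<Suc (length w)]"

definition Stab :: "nat \<Rightarrow> nat set set \<Rightarrow> (nat \<Rightarrow> nat) set \<Rightarrow> (nat \<Rightarrow> nat) set" where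
  "Stab n \<pi> G = {\<sigma> \<in> G. \<exists>w. word_of_partition n \<pi> w \<and> word_act w \<sigma> = w}"

lemma word_act_eq_iff:
  assumes s: "\<sigma> permutes {1..n}" and p: "partition_on {1..n} \<pi>" and w: "word_of_partition n \<pi> w"
  shows "word_act w \<sigma> = w \<longleftrightarrow> (\<forall>B\<in>\<pi>. \<sigma> ` B = B)"
proof -
  have len: "length w = n" using w by (simp add: word_of_partition_def)
  have "word_act w \<sigma> = w \<longleftrightarrow> (\<forall>i<n. w ! (\<sigma> (Suc i) - 1) = w ! i)"
    by (auto simp: list_eq_iff_nth_eq word_act_def len simp del: upt_Suc)
  also have "\<dots> \<longleftrightarrow> (\<forall>i\<in>{1..n}. w ! (\<sigma> i - 1) = w ! (i - 1))"
    by (auto simp: Suc_le_eq dest: bspec[of _ _ "Suc _"])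
      (metis Suc_le_eq Suc_pred diff_Suc_1 One_nat_def)
  also have "\<dots> \<longleftrightarrow> (\<forall>i\<in>{1..n}. \<exists>B\<in>\<pi>. \<sigma> i \<in> B \<and> i \<in> B)"
  proof (rule ball_cong[OF refl])
    fix i assume i: "i \<in> {1..n}"
    then have "\<sigma> i \<in> {1..n}" using permutes_in_image[OF s] by blast
    then show "w ! (\<sigma> i - 1) = w ! (i - 1) \<longleftrightarrow> (\<exists>B\<in>\<pi>. \<sigma> i \<in> B \<and> i \<in> B)"
      using w i unfolding word_of_partition_def by blast
  qed
  also have "\<dots> \<longleftrightarrow> (\<forall>B\<in>\<pi>. \<sigma> ` B = B)"
  proof
    assume *: "\<forall>i\<in>{1..n}. \<exists>B\<in>\<pi>. \<sigma> i \<in> B \<and> i \<in> B"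
    show "\<forall>B\<in>\<pi>. \<sigma> ` B = B"
    proof
      fix B assume B: "B \<in> \<pi>"
      have Bn: "B \<subseteq> {1..n}" using p B unfolding partition_on_def by blast
      have "\<sigma> ` B \<subseteq> B"
      proof
        fix y assume "y \<in> \<sigma> ` B"
        then obtain x where x: "x \<in> B" "y = \<sigma> x" by blast
        then obtain C where "C \<in> \<pi>" "y \<in> C" "x \<in> C" using * Bn by blast
        moreover from this have "C = B" using partition_block_eq[OF p _ B _ x(1)] by simp
        ultimately show "y \<in> B" by simp
      qed
      then show "\<sigma> ` B = B"
        by (meson Bn endo_inj_surj finite_atLeastAtMost finite_subset inj_on_subset
            permutes_inj_on s)
    qed
  next
    assume "\<forall>B\<in>\<pi>. \<sigma> ` B = B"
    then show "\<forall>i\<in>{1..n}. \<exists>B\<in>\<pi>. \<sigma> i \<in> B \<and> i \<in> B"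
      using p unfolding partition_on_def by blast
  qed
  finally show ?thesis .
qed

lemma ex_word_of_partition:
  assumes p: "partition_on {1..n} \<pi>"
  shows "\<exists>w. word_of_partition n \<pi> w"
proof -
  define b where "b i = (THE B. B \<in> \<pi> \<and> i \<in> B)" for i
  have b: "b i = B" if "B \<in> \<pi>" "i \<in> B" for i B
    unfolding b_def using partition_block_eq[OF p] that by (intro the_equality) blast+
  have mem: "b i \<in> \<pi> \<and> i \<in> b i" if "i \<in> {1..n}" for i
    using that b p unfolding partition_on_def by blast
  have Min: "Min B \<in> B" if "B \<in> \<pi>" for B
  proof (rule Min_in)
    show "finite B" using p that by (metis Sup_upper finite_atLeastAtMost finite_subset partition_onD1)
    show "B \<noteq> {}" using p that unfolding partition_on_def by blast
  qed
  have "Min (b i) = Min (b j) \<longleftrightarrow> (\<exists>B\<in>\<pi>. i \<in> B \<and> j \<in> B)" if "i \<in> {1..n}" "j \<in> {1..n}" for i j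
    using mem that Min b by metis
  moreover have "map (\<lambda>i. Min (b i)) [1..<Suc n] ! (i - 1) = Min (b i)" if "i \<in> {1..n}" for i
    using that by (auto simp: nth_map less_Suc_eq_le simp del: upt_Suc)
  ultimately have "word_of_partition n \<pi> (map (\<lambda>i. Min (b i)) [1..<Suc n])"
    unfolding word_of_partition_def by (metis diff_Suc_1 length_map length_upt)
  then show ?thesis by blast
qed

lemma Stab_eq:
  assumes "G \<subseteq> carrier (sym_group n)" and p: "partition_on {1..n} \<pi>"
  shows "Stab n \<pi> G = {\<sigma> \<in> G. \<forall>B\<in>\<pi>. \<sigma> ` B = B}"
proof -
  obtain w where w: "word_of_partition n \<pi> w" using ex_word_of_partition[OF p] by blast
  have "(\<exists>w. word_of_partition n \<pi> w \<and> word_act w \<sigma> = w) \<longleftrightarrow> (\<forall>B\<in>\<pi>. \<sigma> ` B = B)" if "\<sigma> \<in> G" for \<sigma>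
  proof -
    have "\<sigma> permutes {1..n}" using assms(1) that sym_group_carrier by blast
    then show ?thesis using w word_act_eq_iff[OF _ p] by blast
  qed
  then show ?thesis unfolding Stab_def by (rule Collect_cong[OF conj_cong[OF refl]])
qed

definition Z_group :: "nat \<Rightarrow> (nat \<Rightarrow> nat) set \<Rightarrow> bwsym" where
  "Z_group n G = (\<Sum>\<sigma>\<in>G. Phi_basis (spl_of n \<sigma> (cycle_support n \<sigma>)))"

end

theory Submission
  imports Defs
begin

text \<open>
  A permutation \<open>\<sigma>\<close> maps every block of \<open>\<pi>\<close> onto itself exactly when each cycle of \<open>\<sigma>\<close> stays
  inside one block, so \<open>\<sigma>\<close> stabilizes \<open>\<pi>\<close> if and only if \<open>\<pi>\<close> is coarser than the cycle support
  of \<open>\<sigma>\<close> (lemma \<open>mem_Stab_iff_refines\<close>). The defining relation of the basis \<open>M\<close> writes the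
  \<open>\<sigma>\<close>-term of \<open>Z_group n G\<close> as a sum over precisely these \<open>\<pi>\<close>. Both sides of the theorem
  therefore add up the same terms over the pairs of \<open>\<sigma> \<in> G\<close> and \<open>\<pi>\<close> coarser than its cycle
  support, grouped by \<open>\<sigma>\<close> on one side and by \<open>\<pi>\<close> on the other.
\<close>

text \<open>
  Both conditions on \<open>\<sigma>\<close> are the invariance of the blocks of \<open>\<pi>\<close>: on the left it says that \<open>\<sigma>\<close>
  fixes a word with level sets \<open>\<pi>\<close>, on the right that \<open>\<sigma>\<close> and \<open>\<pi>\<close> encode a set partition
  into lists.
\<close>

lemma mem_Stab_iff_refines:
  assumes G: "G \<subseteq> carrier (sym_group n)" and \<sigma>: "\<sigma> \<in> G" and \<pi>: "partition_on {1..n} \<pi>"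
  shows "\<sigma> \<in> Stab n \<pi> G \<longleftrightarrow> refines {1..n} (cycle_support n \<sigma>) \<pi>"
proof -
  have s: "\<sigma> permutes {1..n}" using G \<sigma> sym_group_carrier by blast
  have "\<sigma> \<in> Stab n \<pi> G \<longleftrightarrow> encodes n \<sigma> \<pi>"
    using \<sigma> by (simp add: Stab_eq[OF G \<pi>] encodes_iff_blocks_invariant[OF s \<pi>])
  then show ?thesis using s by (simp add: encodes_def)
qed

lemma Phi_basis_cycle_support:
  assumes s: "\<sigma> permutes {1..n}"
  shows "Phi_basis (spl_of n \<sigma> (cycle_support n \<sigma>)) =
    (\<Sum>\<pi> | refines {1..n} (cycle_support n \<sigma>) \<pi>. M_basis (spl_of n \<sigma> \<pi>))"
proof -
  have "encodes n \<sigma> (cycle_support n \<sigma>)"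
    using s refines_refl[OF partition_on_cycle_support[OF s]] by (simp add: encodes_def)
  then show ?thesis using M_basis_relations unfolding M_relations_def by blast
qed

theorem theorem4p5:
  fixes n :: nat and G :: "(nat \<Rightarrow> nat) set"
  assumes "n \<ge> 1" and "subgroup G (sym_group n)"
  shows "Z_group n G =
    (\<Sum>\<pi> | partition_on {1..n} \<pi>. \<Sum>\<sigma>\<in>Stab n \<pi> G. M_basis (spl_of n \<sigma> \<pi>))"
proof -
  let ?P = "{\<pi>. partition_on {1..n} \<pi>}"
  let ?R = "\<lambda>\<sigma> \<pi>. refines {1..n} (cycle_support n \<sigma>) \<pi>"
  let ?M = "\<lambda>\<sigma> \<pi>. M_basis (spl_of n \<sigma> \<pi>)"
  have G: "G \<subseteq> carrier (sym_group n)" using assms(2) by (rule subgroup.subset)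
  have perm: "\<sigma> permutes {1..n}" if "\<sigma> \<in> G" for \<sigma> using G that sym_group_carrier by blast
  have finG: "finite G"
    using perm by (intro finite_subset[OF _ finite_permutations[of "{1..n}"]]) auto
  have finP: "finite ?P" by (simp add: finitely_many_partition_on)
  have coarser: "{\<pi>. ?R \<sigma> \<pi>} = {\<pi> \<in> ?P. ?R \<sigma> \<pi>}" for \<sigma> by (auto simp: refines_def)
  have Stab: "Stab n \<pi> G = {\<sigma> \<in> G. ?R \<sigma> \<pi>}" if "\<pi> \<in> ?P" for \<pi>
    using that mem_Stab_iff_refines[OF G] by (auto simp: Stab_def)
  have "Z_group n G = (\<Sum>\<sigma>\<in>G. \<Sum>\<pi> | \<pi> \<in> ?P \<and> ?R \<sigma> \<pi>. ?M \<sigma> \<pi>)"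
    unfolding Z_group_def
    by (intro sum.cong refl) (simp only: Phi_basis_cycle_support[OF perm] coarser)
  also have "\<dots> = (\<Sum>\<pi>\<in>?P. \<Sum>\<sigma> | \<sigma> \<in> G \<and> ?R \<sigma> \<pi>. ?M \<sigma> \<pi>)"
    by (rule sum.swap_restrict[OF finG finP])
  also have "\<dots> = (\<Sum>\<pi>\<in>?P. \<Sum>\<sigma>\<in>Stab n \<pi> G. ?M \<sigma> \<pi>)"
    by (intro sum.cong refl) (simp_all only: Stab)
  finally show ?thesis .
qed

end
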